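(* Let $k\in\mathbb{N}$, $k\ge1$, let $u,v\in H^2(\mathbb{D})$ be nonzero, and let $T=S_k+u\otimes v$ on $H^2(\mathbb{D})$. Suppose $T$ is not an isometry and $\{v,S_k^*u\}$ is linearly dependent. Then $T$ is quasinormal if and only if $v$ is an eigenvector of $S_k^*$ and $$(1+\langle S_k^*u,v\rangle)\,\langle z^kv,g_i\rangle+\|v\|^2\sum_{n=0}^{k-1}\langle u,z^n\rangle\langle z^n,g_i\rangle=0\qquad\text{for all } i=1,\ldots,m\ (\le k),$$ where $\{g_1,\ldots,g_m\}$ is an orthonormal basis of $\ker(I-T^*T)\ominus S_k\ker(I-T^*T)$.
   Context: $H^2(\mathbb{D})$ is the Hardy space on the unit disc with orthonormal basis $\{z^n\}_{n\ge0}$; $S_k$ is the shift of multiplicity $k$: $S_kz^n=z^{n+k}$ (multiplication by $z^k$). Inner products are linear in the first variable, and $(u\otimes v)f=\langle f,v\rangle u$. An operator $T$ is quasinormal if $T(T^*T)=(T^*T)T$. An eigenvector is a nonzero vector with any complex eigenvalue (zero allowed). For a closed $S_k$-invariant subspace $\mathcal{K}$, $\mathcal{K}\ominus S_k\mathcal{K}=\mathcal{K}\cap(S_k\mathcal{K})^\perp$, which has dimension at most $k$ and generates $\mathcal{K}$ as an $S_k$-invariant subspace; the displayed condition is to be read for $\ker(I-T^*T)$ being $S_k$-invariant. *)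

theory Defs
  imports "HOL-Complex_Analysis.Complex_Analysis"
begin

section \<open>The Hardy space of the unit disc\<close>

definition taylor_coeff :: "(complex \<Rightarrow> complex) \<Rightarrow> nat \<Rightarrow> complex" where
  "taylor_coeff f n = fps_nth (fps_expansion f 0) n"

text \<open>
  HOL functions are total, so a function on the disc is represented by its extension by zero;
  this makes equality of elements the same as equality on the disc.
\<close>

definition hardy_set :: "(complex \<Rightarrow> complex) set" where
  "hardy_set = {f. f holomorphic_on ball 0 1 \<and> (\<forall>z. z \<notin> ball 0 1 \<longrightarrow> f z = 0)
                  \<and> summable (\<lambda>n. (cmod (taylor_coeff f n))\<^sup>2)}"

lemma hardy_set_has_fps_expansion:
  assumes "f \<in> hardy_set"
  shows "f has_fps_expansion fps_expansion f 0"
  using assms by (auto simp: hardy_set_def intro!: has_fps_expansion_fps_expansion[of "ball 0 1"])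

lemma summable_square_add:
  fixes a b :: "nat \<Rightarrow> complex"
  assumes "summable (\<lambda>n. (cmod (a n))\<^sup>2)" "summable (\<lambda>n. (cmod (b n))\<^sup>2)"
  shows "summable (\<lambda>n. (cmod (a n + b n))\<^sup>2)"
proof (rule summable_comparison_test')
  show "summable (\<lambda>n. 2 * (cmod (a n))\<^sup>2 + 2 * (cmod (b n))\<^sup>2)"
    by (intro summable_add summable_mult assms)
  fix n
  have "(cmod (a n + b n))\<^sup>2 \<le> (cmod (a n) + cmod (b n))\<^sup>2"
    by (intro power_mono norm_triangle_ineq) auto
  also have "\<dots> \<le> 2 * (cmod (a n))\<^sup>2 + 2 * (cmod (b n))\<^sup>2"
    using sum_squares_bound[of "cmod (a n)" "cmod (b n)"] by (simp add: power2_sum)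
  finally show "norm ((cmod (a n + b n))\<^sup>2) \<le> 2 * (cmod (a n))\<^sup>2 + 2 * (cmod (b n))\<^sup>2"
    by simp
qed

lemma summable_square_mult:
  fixes a b :: "nat \<Rightarrow> complex"
  assumes "summable (\<lambda>n. (cmod (a n))\<^sup>2)" "summable (\<lambda>n. (cmod (b n))\<^sup>2)"
  shows "summable (\<lambda>n. a n * cnj (b n))"
proof (rule summable_comparison_test')
  show "summable (\<lambda>n. (cmod (a n))\<^sup>2 + (cmod (b n))\<^sup>2)"
    by (intro summable_add assms)
  fix n
  show "norm (a n * cnj (b n)) \<le> (cmod (a n))\<^sup>2 + (cmod (b n))\<^sup>2"
    using sum_squares_bound[of "cmod (a n)" "cmod (b n)"]
      mult_nonneg_nonneg[OF norm_ge_zero norm_ge_zero, of "a n" "b n"]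
    unfolding norm_mult complex_mod_cnj by linarith
qed

lemma taylor_coeff_eqI: "f has_fps_expansion F \<Longrightarrow> taylor_coeff f = fps_nth F"
  by (auto simp: taylor_coeff_def fps_expansion_eqI)

lemma taylor_coeff_add:
  assumes "f \<in> hardy_set" "g \<in> hardy_set"
  shows "taylor_coeff (\<lambda>z. f z + g z) = (\<lambda>n. taylor_coeff f n + taylor_coeff g n)"
  using taylor_coeff_eqI[OF has_fps_expansion_add[OF assms[THEN hardy_set_has_fps_expansion]]]
  by (auto simp: taylor_coeff_def)

lemma taylor_coeff_cmult:
  assumes "f \<in> hardy_set"
  shows "taylor_coeff (\<lambda>z. c * f z) = (\<lambda>n. c * taylor_coeff f n)"
  using taylor_coeff_eqI[OF has_fps_expansion_cmult_left[OF hardy_set_has_fps_expansion[OF assms]]]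
  by (auto simp: taylor_coeff_def)

lemma taylor_coeff_power_mult:
  assumes "f \<in> hardy_set"
  shows "taylor_coeff (\<lambda>z. z ^ k * f z) = (\<lambda>n. if n < k then 0 else taylor_coeff f (n - k))"
  using taylor_coeff_eqI[OF has_fps_expansion_mult
      [OF has_fps_expansion_fps_X_power hardy_set_has_fps_expansion[OF assms]], of k]
  by (auto simp: taylor_coeff_def fps_X_power_mult_nth)

lemma taylor_coeff_zero: "taylor_coeff (\<lambda>z. 0) = (\<lambda>n. 0)"
  using taylor_coeff_eqI[OF has_fps_expansion_0] by auto

lemma taylor_coeff_disc_power:
  "taylor_coeff (\<lambda>z. if z \<in> ball 0 1 then z ^ n else 0) = (\<lambda>j. if j = n then 1 else 0)"
proof -
  have "eventually (\<lambda>z::complex. z \<in> ball 0 1) (nhds 0)"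
    by (rule eventually_nhds_in_open) auto
  then have "eventually (\<lambda>z::complex. (if z \<in> ball 0 1 then z ^ n else 0) = z ^ n) (nhds 0)"
    by eventually_elim auto
  then have "(\<lambda>z::complex. if z \<in> ball 0 1 then z ^ n else 0) has_fps_expansion fps_X ^ n"
    using has_fps_expansion_cong[OF _ refl, THEN iffD2] has_fps_expansion_fps_X_power[of n] by auto
  from taylor_coeff_eqI[OF this] show ?thesis by (auto simp: fps_X_power_iff)
qed

lemma taylor_coeff_eq_zeroD:
  assumes "f \<in> hardy_set" "\<And>n. taylor_coeff f n = 0"
  shows "f = (\<lambda>z. 0)"
proof
  fix z
  have "fps_expansion f 0 = 0"
    using assms(2) by (auto simp: taylor_coeff_def fps_eq_iff)
  then have "f has_fps_expansion 0"
    using hardy_set_has_fps_expansion[OF assms(1)] by simp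
  then show "f z = 0"
    using assms(1) has_fps_expansion_0_analytic_continuation[of f "ball 0 1" z]
    by (cases "z \<in> ball 0 1") (auto simp: hardy_set_def)
qed

lemma hardy_set_add: "f \<in> hardy_set \<Longrightarrow> g \<in> hardy_set \<Longrightarrow> (\<lambda>z. f z + g z) \<in> hardy_set"
  using taylor_coeff_add[of f g] summable_square_add
  by (auto simp: hardy_set_def intro!: holomorphic_intros)

lemma hardy_set_cmult: "f \<in> hardy_set \<Longrightarrow> (\<lambda>z. c * f z) \<in> hardy_set"
  using taylor_coeff_cmult[of f c]
  by (auto simp: hardy_set_def norm_mult power_mult_distrib intro!: holomorphic_intros summable_mult)

lemma hardy_set_zero: "(\<lambda>z. 0) \<in> hardy_set"
  by (auto simp: hardy_set_def taylor_coeff_zero)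

lemma hardy_set_power_mult:
  assumes "f \<in> hardy_set"
  shows "(\<lambda>z. z ^ k * f z) \<in> hardy_set"
proof -
  have "summable (\<lambda>n. (cmod (taylor_coeff (\<lambda>z. z ^ k * f z) n))\<^sup>2)"
    unfolding taylor_coeff_power_mult[OF assms]
    by (rule summable_iff_shift[of _ k, THEN iffD1]) (use assms in \<open>simp add: hardy_set_def\<close>)
  then show ?thesis
    using assms by (auto simp: hardy_set_def intro!: holomorphic_intros)
qed

lemma hardy_set_disc_power: "(\<lambda>z. if z \<in> ball 0 1 then z ^ n else 0) \<in> hardy_set"
proof -
  have "(\<lambda>z::complex. if z \<in> ball 0 1 then z ^ n else 0) holomorphic_on ball 0 1 \<longleftrightarrow>
        (\<lambda>z. z ^ n) holomorphic_on ball 0 1"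
    by (rule holomorphic_cong) auto
  moreover have "(\<lambda>z::complex. z ^ n) holomorphic_on ball 0 1"
    by (intro holomorphic_intros)
  moreover have "summable (\<lambda>j. (cmod (if j = n then 1 else 0))\<^sup>2)"
    by (rule summable_finite[of "{n}"]) auto
  ultimately show ?thesis
    unfolding hardy_set_def taylor_coeff_disc_power mem_Collect_eq by auto
qed

typedef hardy = hardy_set
  morphisms hardy_fun Abs_hardy
  using hardy_set_zero by blast

setup_lifting type_definition_hardy

instantiation hardy :: ab_group_add
begin

lift_definition zero_hardy :: hardy is "\<lambda>z. 0"
  by (rule hardy_set_zero)

lift_definition plus_hardy :: "hardy \<Rightarrow> hardy \<Rightarrow> hardy" is "\<lambda>f g z. f z + g z"
  by (rule hardy_set_add)

lift_definition uminus_hardy :: "hardy \<Rightarrow> hardy" is "\<lambda>f z. - f z"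
  using hardy_set_cmult[of _ "-1"] by simp

definition minus_hardy :: "hardy \<Rightarrow> hardy \<Rightarrow> hardy" where
  "minus_hardy f g = f + (- g)"

instance
  by standard (unfold minus_hardy_def, (transfer, simp add: add_ac)+)

end

lift_definition scaleC :: "complex \<Rightarrow> hardy \<Rightarrow> hardy" (infixr \<open>*\<^sub>C\<close> 75) is "\<lambda>c f z. c * f z"
  by (rule hardy_set_cmult)

global_interpretation hardy: vector_space scaleC
  by standard (transfer, simp add: algebra_simps)+

definition hcoeff :: "hardy \<Rightarrow> nat \<Rightarrow> complex" where
  "hcoeff f n = taylor_coeff (hardy_fun f) n"

text \<open>The inner product for which the monomials are an orthonormal basis,
  linear in the first argument.\<close>

definition cinner :: "hardy \<Rightarrow> hardy \<Rightarrow> complex" where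
  "cinner f g = (\<Sum>n. hcoeff f n * cnj (hcoeff g n))"

lemma hcoeff_zero [simp]: "hcoeff 0 n = 0"
  by (simp add: hcoeff_def zero_hardy.rep_eq taylor_coeff_zero)

lemma hcoeff_add [simp]: "hcoeff (f + g) n = hcoeff f n + hcoeff g n"
  by (simp add: hcoeff_def plus_hardy.rep_eq taylor_coeff_add hardy_fun)

lemma hcoeff_scaleC [simp]: "hcoeff (c *\<^sub>C f) n = c * hcoeff f n"
  by (simp add: hcoeff_def scaleC.rep_eq taylor_coeff_cmult hardy_fun)

lemma summable_hcoeff: "summable (\<lambda>n. (cmod (hcoeff f n))\<^sup>2)"
  using hardy_fun[of f] by (simp add: hcoeff_def hardy_set_def)

lemma hcoeff_eq_zeroD: "(\<And>n. hcoeff f n = 0) \<Longrightarrow> f = 0"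
  using taylor_coeff_eq_zeroD[OF hardy_fun, of f]
  by (simp add: hcoeff_def zero_hardy.rep_eq flip: hardy_fun_inject)

lemma summable_cinner: "summable (\<lambda>n. hcoeff f n * cnj (hcoeff g n))"
  by (intro summable_square_mult summable_hcoeff)

lemma cinner_add_left: "cinner (f + g) h = cinner f h + cinner g h"
  by (simp add: cinner_def distrib_right suminf_add summable_cinner)

lemma cinner_scaleC_left: "cinner (c *\<^sub>C f) g = c * cinner f g"
  by (simp add: cinner_def mult.assoc suminf_mult summable_cinner)

lemma cinner_commute: "cinner f g = cnj (cinner g f)"
proof -
  have "(\<lambda>n. cnj (hcoeff g n * cnj (hcoeff f n))) sums cnj (cinner g f)"
    unfolding cinner_def sums_cnj by (rule summable_sums[OF summable_cinner])
  then show ?thesis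
    by (simp add: cinner_def sums_iff mult.commute)
qed

lemma cinner_self: "cinner f f = of_real (\<Sum>n. (cmod (hcoeff f n))\<^sup>2)"
proof -
  have "(\<lambda>n. complex_of_real ((cmod (hcoeff f n))\<^sup>2)) sums of_real (\<Sum>n. (cmod (hcoeff f n))\<^sup>2)"
    by (intro sums_of_real summable_sums summable_hcoeff)
  then show ?thesis
    by (simp add: cinner_def sums_iff flip: complex_norm_square)
qed

instantiation hardy :: real_inner
begin

definition scaleR_hardy :: "real \<Rightarrow> hardy \<Rightarrow> hardy" where
  "scaleR_hardy r f = of_real r *\<^sub>C f"

definition inner_hardy :: "hardy \<Rightarrow> hardy \<Rightarrow> real" where
  "inner_hardy f g = Re (cinner f g)"

definition norm_hardy :: "hardy \<Rightarrow> real" where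
  "norm_hardy f = sqrt (Re (cinner f f))"

definition sgn_hardy :: "hardy \<Rightarrow> hardy" where
  "sgn_hardy f = scaleR (inverse (norm f)) f"

definition dist_hardy :: "hardy \<Rightarrow> hardy \<Rightarrow> real" where
  "dist_hardy f g = norm (f - g)"

definition uniformity_hardy :: "(hardy \<times> hardy) filter" where
  "uniformity_hardy = (INF e\<in>{0<..}. principal {(x, y). dist x y < e})"

definition open_hardy :: "hardy set \<Rightarrow> bool" where
  "open_hardy U \<longleftrightarrow> (\<forall>x\<in>U. eventually (\<lambda>(x', y). x' = x \<longrightarrow> y \<in> U) uniformity)"

instance
proof
  fix f g h :: hardy and r s :: real
  show "r *\<^sub>R (f + g) = r *\<^sub>R f + r *\<^sub>R g"
    by (simp add: scaleR_hardy_def hardy.scale_right_distrib)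
  show "(r + s) *\<^sub>R f = r *\<^sub>R f + s *\<^sub>R f"
    by (simp add: scaleR_hardy_def hardy.scale_left_distrib)
  show "r *\<^sub>R s *\<^sub>R f = (r * s) *\<^sub>R f" "1 *\<^sub>R f = f"
    by (simp_all add: scaleR_hardy_def)
  show "sgn f = inverse (norm f) *\<^sub>R f"
    by (simp add: sgn_hardy_def)
  show "dist f g = norm (f - g)"
    by (simp add: dist_hardy_def)
  show "uniformity = (INF e\<in>{0<..}. principal {(x::hardy, y). dist x y < e})"
    by (simp add: uniformity_hardy_def)
  show "open U \<longleftrightarrow> (\<forall>x\<in>U. eventually (\<lambda>(x', y). x' = x \<longrightarrow> y \<in> U) uniformity)"
    for U :: "hardy set"
    by (simp add: open_hardy_def)
  show "inner f g = inner g f"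
    using cinner_commute[of f g] by (simp add: inner_hardy_def)
  show "inner (f + g) h = inner f h + inner g h"
    by (simp add: inner_hardy_def cinner_add_left)
  show "inner (r *\<^sub>R f) g = r * inner f g"
    by (simp add: inner_hardy_def scaleR_hardy_def cinner_scaleC_left)
  show "0 \<le> inner f f"
    by (simp add: inner_hardy_def cinner_self suminf_nonneg summable_hcoeff)
  show "inner f f = 0 \<longleftrightarrow> f = 0"
    using suminf_eq_zero_iff[OF summable_hcoeff[of f]] hcoeff_eq_zeroD[of f]
    by (auto simp: inner_hardy_def cinner_self)
  show "norm f = sqrt (inner f f)"
    by (simp add: norm_hardy_def inner_hardy_def)
qed

end

lift_definition hmonom :: "nat \<Rightarrow> hardy" is "\<lambda>n z. if z \<in> ball 0 1 then z ^ n else 0"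
  by (rule hardy_set_disc_power)


section \<open>Operators\<close>

lift_definition shift :: "nat \<Rightarrow> hardy \<Rightarrow> hardy" is "\<lambda>k f z. z ^ k * f z"
  by (rule hardy_set_power_mult)

lemma hcoeff_hmonom [simp]: "hcoeff (hmonom n) j = (if j = n then 1 else 0)"
  unfolding hcoeff_def hmonom.rep_eq taylor_coeff_disc_power ..

lemma hcoeff_shift [simp]: "hcoeff (shift k f) n = (if n < k then 0 else hcoeff f (n - k))"
  by (simp add: hcoeff_def shift.rep_eq taylor_coeff_power_mult hardy_fun)

lemma shift_hmonom: "shift k (hmonom n) = hmonom (n + k)"
  by transfer (auto simp: fun_eq_iff power_add)

definition rank_one :: "hardy \<Rightarrow> hardy \<Rightarrow> hardy \<Rightarrow> hardy" (infix \<open>\<otimes>\<^sub>H\<close> 70) where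
  "(u \<otimes>\<^sub>H v) f = cinner f v *\<^sub>C u"

text \<open>The Hilbert space adjoint of a bounded complex-linear operator.  At most one map can satisfy
  the defining identity; for an operator without adjoint the value is unspecified.\<close>

definition cadjoint :: "(hardy \<Rightarrow> hardy) \<Rightarrow> hardy \<Rightarrow> hardy" where
  "cadjoint A = (THE B. \<forall>f g. cinner (A f) g = cinner f (B g))"

definition quasinormal :: "(hardy \<Rightarrow> hardy) \<Rightarrow> bool" where
  "quasinormal A \<longleftrightarrow> A \<circ> (cadjoint A \<circ> A) = (cadjoint A \<circ> A) \<circ> A"

definition isometric_op :: "(hardy \<Rightarrow> hardy) \<Rightarrow> bool" where
  "isometric_op A \<longleftrightarrow> (\<forall>f. norm (A f) = norm f)"

definition is_eigenvector :: "(hardy \<Rightarrow> hardy) \<Rightarrow> hardy \<Rightarrow> bool" where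
  "is_eigenvector A f \<longleftrightarrow> f \<noteq> 0 \<and> (\<exists>\<mu>. A f = \<mu> *\<^sub>C f)"

definition ker_op :: "(hardy \<Rightarrow> hardy) \<Rightarrow> hardy set" where
  "ker_op A = {f. A f = 0}"

definition ortho_compl :: "hardy set \<Rightarrow> hardy set" where
  "ortho_compl M = {f. \<forall>g\<in>M. cinner f g = 0}"

definition ominus :: "hardy set \<Rightarrow> hardy set \<Rightarrow> hardy set" (infixl \<open>\<ominus>\<^sub>H\<close> 65) where
  "K \<ominus>\<^sub>H M = K \<inter> ortho_compl M"

text \<open>Dependence of the two-member family, not of the set: for equal nonzero vectors
  the set would be independent.\<close>

definition dependent_pair :: "hardy \<Rightarrow> hardy \<Rightarrow> bool" where
  "dependent_pair f g \<longleftrightarrow> (\<exists>a b. (a \<noteq> 0 \<or> b \<noteq> 0) \<and> a *\<^sub>C f + b *\<^sub>C g = 0)"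

text \<open>\<open>g 1, \<dots>, g m\<close> is an orthonormal basis of the (finite-dimensional) subspace \<open>M\<close>;
  \<^const>\<open>hardy.span\<close> is the complex linear span.\<close>

definition orthonormal_basis :: "nat \<Rightarrow> (nat \<Rightarrow> hardy) \<Rightarrow> hardy set \<Rightarrow> bool" where
  "orthonormal_basis m g M \<longleftrightarrow>
     (\<forall>i\<in>{1..m}. \<forall>j\<in>{1..m}. cinner (g i) (g j) = (if i = j then 1 else 0)) \<and>
     hardy.span (g ` {1..m}) = M"

end

theory Submission
  imports Defs
begin

text \<open>
  Write \<open>S\<close> for the shift. Since \<open>S\<^sup>* u = \<alpha> v\<close>, one finds \<open>T\<^sup>* T = I + \<gamma> v \<otimes> v\<close> with a scalar \<open>\<gamma>\<close>,
  nonzero because \<open>T\<close> is not an isometry. Hence \<open>K\<close> is the orthogonal complement of \<open>v\<close>, and \<open>T\<close> is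
  quasinormal iff it commutes with \<open>v \<otimes> v\<close>, that is, iff \<open>v\<close> is an eigenvector of both \<open>T\<close> and \<open>T\<^sup>*\<close>.
  For \<open>T\<^sup>* = S\<^sup>* + v \<otimes> u\<close> this means that \<open>v\<close> is an eigenvector of \<open>S\<^sup>*\<close>. Splitting \<open>u\<close> into
  its Taylor polynomial of degree below \<open>k\<close> and \<open>S S\<^sup>* u = \<alpha> S v\<close> shows that the displayed expression is
  \<open>\<langle>T v, g\<^sub>i\<rangle>\<close>. As \<open>S\<^sup>* T v\<close> is a multiple of \<open>v\<close>, the vector \<open>T v\<close> is always orthogonal to \<open>S K\<close>;
  so the condition says that \<open>T v\<close> is orthogonal to \<open>K\<close>, i.e. a multiple of \<open>v\<close>.
\<close>

section \<open>Coefficients and the inner product\<close>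

lemma hcoeff_uminus [simp]: "hcoeff (- f) n = - hcoeff f n"
  using hcoeff_add[of f "- f" n] by (simp add: eq_neg_iff_add_eq_0 add.commute)

lemma hcoeff_diff [simp]: "hcoeff (f - g) n = hcoeff f n - hcoeff g n"
  using hcoeff_add[of f "- g" n] by simp

lemma hcoeff_sum [simp]: "hcoeff (sum f A) n = (\<Sum>x\<in>A. hcoeff (f x) n)"
  by (induction A rule: infinite_finite_induct) auto

lemma hardy_eqI: "(\<And>n. hcoeff f n = hcoeff g n) \<Longrightarrow> f = g"
  using hcoeff_eq_zeroD[of "f - g"] by simp

lemma cinner_zero_left [simp]: "cinner 0 g = 0"
  and cinner_zero_right [simp]: "cinner f 0 = 0"
  by (simp_all add: cinner_def)

lemma cinner_add_right: "cinner f (g + h) = cinner f g + cinner f h"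
  using cinner_add_left[of g h f] by (metis cinner_commute complex_cnj_add)

lemma cinner_scaleC_right: "cinner f (c *\<^sub>C g) = cnj c * cinner f g"
  using cinner_scaleC_left[of c g f] by (metis cinner_commute complex_cnj_mult)

lemma cinner_diff_left: "cinner (f - g) h = cinner f h - cinner g h"
  using cinner_add_left[of "f - g" g h] by simp

lemma cinner_diff_right: "cinner f (g - h) = cinner f g - cinner f h"
  using cinner_add_right[of f "g - h" h] by simp

lemma cinner_sum_left: "cinner (sum f A) h = (\<Sum>x\<in>A. cinner (f x) h)"
  by (induction A rule: infinite_finite_induct) (auto simp: cinner_add_left)

lemma cinner_self_norm: "cinner f f = of_real ((norm f)\<^sup>2)"
  using cinner_self[of f]
  by (metis Re_complex_of_real inner_hardy_def power2_norm_eq_inner)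

lemma cinner_self_eq_0_iff [simp]: "cinner f f = 0 \<longleftrightarrow> f = 0"
  by (simp add: cinner_self_norm)

lemma cinner_eq_0_commute: "cinner f g = 0 \<longleftrightarrow> cinner g f = 0"
  using cinner_commute[of f g] by simp

lemma cinner_eqI:
  assumes "\<And>f. cinner f x = cinner f y"
  shows "x = y"
proof -
  have "cinner (x - y) (x - y) = 0"
    using assms[of "x - y"] by (simp add: cinner_diff_right)
  then show ?thesis by simp
qed

lemma cinner_hmonom_left: "cinner (hmonom n) g = cnj (hcoeff g n)"
proof -
  have "(\<lambda>j. hcoeff (hmonom n) j * cnj (hcoeff g j)) = (\<lambda>j. if j = n then cnj (hcoeff g j) else 0)"
    by auto
  then show ?thesis
    unfolding cinner_def using sums_single[of n "\<lambda>j. cnj (hcoeff g j)"] by (simp add: sums_iff)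
qed

lemma cinner_hmonom_right: "cinner g (hmonom n) = hcoeff g n"
  by (metis cinner_commute cinner_hmonom_left complex_cnj_cnj)

text \<open>This is the double orthogonal complement of a line. The component \<open>h\<close> of
  \<open>x\<close> orthogonal to \<open>v\<close> is orthogonal to \<open>x\<close> by hypothesis,
  hence to itself.\<close>

lemma proportionalI:
  assumes "v \<noteq> 0" and "\<And>h. cinner h v = 0 \<Longrightarrow> cinner x h = 0"
  shows "\<exists>c. x = c *\<^sub>C v"
proof
  define c where "c = cinner x v / cinner v v"
  define h where "h = x - c *\<^sub>C v"
  have hv: "cinner h v = 0"
    using assms(1) by (simp add: h_def c_def cinner_diff_left cinner_scaleC_left)
  then have "cinner h h = cinner x h - c * cinner v h"
    by (subst h_def) (simp add: cinner_diff_left cinner_scaleC_left)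
  also have "\<dots> = 0"
    using assms(2)[OF hv] hv cinner_eq_0_commute[of h v] by simp
  finally show "x = (cinner x v / cinner v v) *\<^sub>C v"
    by (simp add: h_def c_def)
qed

lemma orthonormal_independent:
  assumes "finite A"
    and "\<And>x y. x \<in> A \<Longrightarrow> y \<in> A \<Longrightarrow> cinner x y = (if x = y then 1 else 0)"
  shows "\<not> hardy.dependent A"
proof
  assume "hardy.dependent A"
  then obtain c y where y: "y \<in> A" "c y \<noteq> 0" and s: "(\<Sum>x\<in>A. c x *\<^sub>C x) = 0"
    using hardy.dependent_finite[OF assms(1)] by auto
  have "0 = cinner (\<Sum>x\<in>A. c x *\<^sub>C x) y"
    by (simp add: s)
  also have "\<dots> = (\<Sum>x\<in>A. if x = y then c x else 0)"
    unfolding cinner_sum_left cinner_scaleC_left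
    by (rule sum.cong) (use assms(2) y(1) in auto)
  also have "\<dots> = c y"
    using y(1) assms(1) by simp
  finally show False
    using y(2) by simp
qed

lemma orthonormal_basis_in:
  assumes "orthonormal_basis m g M" "i \<in> {1..m}"
  shows "g i \<in> M"
  using assms hardy.span_base[of "g i" "g ` {1..m}"] by (auto simp: orthonormal_basis_def)

lemma orthonormal_basis_orthogonal_all:
  assumes "orthonormal_basis m g M" "\<And>i. i \<in> {1..m} \<Longrightarrow> cinner x (g i) = 0" "y \<in> M"
  shows "cinner x y = 0"
proof -
  have "y \<in> hardy.span (g ` {1..m})"
    using assms by (simp add: orthonormal_basis_def)
  then show ?thesis
    by (induction rule: hardy.span_induct_alt)
      (use assms(2) in \<open>auto simp: cinner_add_right cinner_scaleC_right\<close>)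
qed

section \<open>The backward shift\<close>

text \<open>For \<open>r < 1\<close> the powers of \<open>r\<close> are square-summable, so their
  products with \<open>a n\<close> are summable. The power series therefore converges on the whole
  disc and defines an element of the space.\<close>

lemma hardy_with_coeffs:
  fixes a :: "nat \<Rightarrow> complex"
  assumes "summable (\<lambda>n. (cmod (a n))\<^sup>2)"
  shows "\<exists>f. \<forall>n. hcoeff f n = a n"
proof -
  define F where "F = Abs_fps a"
  have "summable (\<lambda>n. a n * of_real r ^ n)" if r: "0 \<le> r" "r < 1" for r :: real
  proof -
    have "summable (\<lambda>n. (cmod (of_real r ^ n))\<^sup>2)"
      using r by (simp add: norm_power power2_eq_square summable_geometric mult_le_one
          mult_strict_mono'[of r 1 r 1, simplified] flip: power_mult_distrib)
    from summable_square_mult[OF assms this] show ?thesis by simp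
  qed
  then have R: "fps_conv_radius F \<ge> 1"
    unfolding fps_conv_radius_def F_def
    by (intro conv_radius_geI_ex') auto
  define h where "h = (\<lambda>z. if z \<in> ball 0 1 then eval_fps F z else 0)"
  have sub: "ball (0::complex) 1 \<subseteq> eball 0 (fps_conv_radius F)"
  proof
    fix z :: complex assume "z \<in> ball 0 1"
    then have "ereal (norm z) < 1" by simp
    then show "z \<in> eball 0 (fps_conv_radius F)"
      using less_le_trans[OF _ R] by simp
  qed
  have "eval_fps F holomorphic_on ball 0 1"
    by (rule holomorphic_on_subset[OF holomorphic_on_eval_fps[OF subset_refl] sub])
  then have hol: "h holomorphic_on ball 0 1"
    by (subst holomorphic_cong[OF refl]) (auto simp: h_def)
  have "eval_fps F has_fps_expansion F"
    using less_le_trans[OF _ R, of 0] by (auto simp: has_fps_expansion_def)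
  moreover have "eventually (\<lambda>z::complex. z \<in> ball 0 1) (nhds 0)"
    by (rule eventually_nhds_in_open) auto
  then have "eventually (\<lambda>z. h z = eval_fps F z) (nhds 0)"
    by eventually_elim (simp add: h_def)
  ultimately have "h has_fps_expansion F"
    using has_fps_expansion_cong[OF _ refl, THEN iffD2] by blast
  from taylor_coeff_eqI[OF this] have t: "taylor_coeff h = a"
    by (auto simp: F_def)
  have "h \<in> hardy_set"
    using hol assms unfolding hardy_set_def mem_Collect_eq t by (simp add: h_def)
  then have "\<forall>n. hcoeff (Abs_hardy h) n = a n"
    by (simp add: hcoeff_def Abs_hardy_inverse t)
  then show ?thesis ..
qed

text \<open>This is the adjoint of the shift, built from coefficients.
  \<open>hardy_with_coeffs\<close> supplies a witness for the choice, and \<open>hardy_eqI\<close>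
  makes it unique.\<close>

definition backshift :: "nat \<Rightarrow> hardy \<Rightarrow> hardy" where
  "backshift k f = (SOME h. \<forall>n. hcoeff h n = hcoeff f (n + k))"

lemma hcoeff_backshift [simp]: "hcoeff (backshift k f) n = hcoeff f (n + k)"
proof -
  have "summable (\<lambda>n. (cmod (hcoeff f (n + k)))\<^sup>2)"
    using summable_hcoeff[of f] by (subst summable_iff_shift[of "\<lambda>n. (cmod (hcoeff f n))\<^sup>2"])
  from someI_ex[OF hardy_with_coeffs[OF this]] show ?thesis
    by (simp add: backshift_def)
qed

lemma backshift_shift [simp]: "backshift k (shift k f) = f"
  by (rule hardy_eqI) simp

lemma backshift_add: "backshift k (f + g) = backshift k f + backshift k g"
  by (rule hardy_eqI) simp

lemma backshift_scaleC: "backshift k (c *\<^sub>C f) = c *\<^sub>C backshift k f"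
  by (rule hardy_eqI) simp

lemma shift_add: "shift k (f + g) = shift k f + shift k g"
  by (rule hardy_eqI) simp

lemma shift_diff: "shift k (f - g) = shift k f - shift k g"
  by (rule hardy_eqI) simp

lemma shift_scaleC: "shift k (c *\<^sub>C f) = c *\<^sub>C shift k f"
  by (rule hardy_eqI) simp

lemma cinner_shift_left: "cinner (shift k f) g = cinner f (backshift k g)"
proof -
  have "cinner (shift k f) g =
      (\<Sum>n. hcoeff (shift k f) (n + k) * cnj (hcoeff g (n + k))) +
      (\<Sum>n<k. hcoeff (shift k f) n * cnj (hcoeff g n))"
    unfolding cinner_def by (rule suminf_split_initial_segment[OF summable_cinner])
  then show ?thesis
    by (simp add: cinner_def)
qed

lemma cinner_shift_right: "cinner f (shift k g) = cinner (backshift k f) g"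
  by (metis cinner_commute cinner_shift_left)

text \<open>The orthogonal projection onto the kernel of \<open>backshift k\<close>: the part of
  \<open>f\<close> outside the range of the shift.\<close>

definition taylor_poly :: "nat \<Rightarrow> hardy \<Rightarrow> hardy" where
  "taylor_poly k f = (\<Sum>n<k. hcoeff f n *\<^sub>C hmonom n)"

lemma shift_decomposition: "f = shift k (backshift k f) + taylor_poly k f"
  by (rule hardy_eqI) (auto simp: taylor_poly_def if_distrib cong: if_cong)

lemma cinner_taylor_poly_left:
  "cinner (taylor_poly k f) g = (\<Sum>n<k. cinner f (hmonom n) * cinner (hmonom n) g)"
  by (simp add: taylor_poly_def cinner_sum_left cinner_scaleC_left cinner_hmonom_right)

lemma backshift_taylor_poly [simp]: "backshift k (taylor_poly k f) = 0"
  by (rule hardy_eqI) (auto simp: taylor_poly_def intro!: sum.neutral)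

lemma taylor_poly_in_span: "taylor_poly k f \<in> hardy.span (hmonom ` {..<k})"
  unfolding taylor_poly_def
  by (intro hardy.span_sum hardy.span_scale hardy.span_base) auto

section \<open>Adjoints and quasinormality\<close>

lemma cadjointI:
  assumes "\<And>f g. cinner (A f) g = cinner f (B g)"
  shows "cadjoint A = B"
  unfolding cadjoint_def
proof (rule the_equality)
  show "\<forall>f g. cinner (A f) g = cinner f (B g)" using assms by blast
  fix C assume "\<forall>f g. cinner (A f) g = cinner f (C g)"
  then show "C = B"
    using assms by (intro ext cinner_eqI) metis
qed

lemma cadjoint_shift: "cadjoint (shift k) = backshift k"
  by (rule cadjointI) (rule cinner_shift_left)

lemma cinner_shift_plus_rank_one:
  "cinner (shift k f + (u \<otimes>\<^sub>H v) f) g = cinner f (backshift k g + (v \<otimes>\<^sub>H u) g)"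
  using cinner_commute[of u g]
  by (simp add: rank_one_def cinner_add_left cinner_add_right cinner_scaleC_left
      cinner_scaleC_right cinner_shift_left)

text \<open>The identity part of \<open>B A\<close> commutes with \<open>A\<close>, so only
  \<open>v \<otimes>\<^sub>H v\<close> matters. Composing it with \<open>A\<close> on the left gives
  \<open>A v \<otimes>\<^sub>H v\<close>, on the right \<open>v \<otimes>\<^sub>H B v\<close>; these
  agree exactly when \<open>v\<close> is an eigenvector of both maps.\<close>

lemma quasinormal_iff_reduces:
  assumes add: "\<And>f g. A (f + g) = A f + A g" and scale: "\<And>c f. A (c *\<^sub>C f) = c *\<^sub>C A f"
    and adj: "\<And>f g. cinner (A f) g = cinner f (B g)"
    and defect: "\<And>f. B (A f) = f + (\<gamma> * cinner f v) *\<^sub>C v"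
    and nz: "\<gamma> \<noteq> 0" "v \<noteq> 0"
  shows "quasinormal A \<longleftrightarrow> (\<exists>c. A v = c *\<^sub>C v) \<and> (\<exists>d. B v = d *\<^sub>C v)"
proof -
  have "quasinormal A \<longleftrightarrow> (\<forall>f. A (B (A f)) = B (A (A f)))"
    by (simp add: quasinormal_def cadjointI[OF adj] fun_eq_iff)
  also have "\<dots> \<longleftrightarrow> (\<forall>f. (\<gamma> * cinner f v) *\<^sub>C A v = (\<gamma> * cinner f (B v)) *\<^sub>C v)"
    by (simp add: defect add scale adj)
  also have "\<dots> \<longleftrightarrow> (\<forall>f. cinner f v *\<^sub>C A v = cinner f (B v) *\<^sub>C v)"
    using nz(1) by (simp flip: hardy.scale_scale)
  also have "\<dots> \<longleftrightarrow> (\<exists>c. A v = c *\<^sub>C v) \<and> (\<exists>d. B v = d *\<^sub>C v)" (is "?l \<longleftrightarrow> ?r")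
  proof
    assume l: ?l
    \<comment> \<open>The rank-one identity at \<open>f = v\<close> forces this scalar. Cancelling
      \<open>v\<close> in the identity at arbitrary \<open>f\<close> then determines
      \<open>B v\<close>.\<close>
    define c where "c = cinner v (B v) / cinner v v"
    have "A v = (inverse (cinner v v) * cinner v v) *\<^sub>C A v"
      using nz by simp
    also have "\<dots> = inverse (cinner v v) *\<^sub>C cinner v (B v) *\<^sub>C v"
      unfolding l[rule_format, symmetric] by simp
    finally have c: "A v = c *\<^sub>C v"
      by (simp add: c_def field_simps)
    have "B v = cnj c *\<^sub>C v"
    proof (rule cinner_eqI)
      fix f
      have "(cinner f v * c) *\<^sub>C v = cinner f (B v) *\<^sub>C v"
        using l[rule_format, of f] by (simp add: c)
      then show "cinner f (B v) = cinner f (cnj c *\<^sub>C v)"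
        using nz by (simp add: cinner_scaleC_right mult.commute)
    qed
    with c show ?r by blast
  next
    assume ?r
    then obtain c d where c: "A v = c *\<^sub>C v" and d: "B v = d *\<^sub>C v" by blast
    \<comment> \<open>The two eigenvalues are tied together by the adjoint relation at the pair
      \<open>v\<close>, \<open>v\<close>.\<close>
    have "c = cnj d"
      using adj[of v v] nz by (simp add: c d cinner_scaleC_left cinner_scaleC_right)
    then show ?l
      by (simp add: c d cinner_scaleC_right mult.commute)
  qed
  finally show ?thesis .
qed

section \<open>The wandering subspace of an invariant hyperplane\<close>

context
  fixes k :: nat and v :: hardy and K :: "hardy set" and \<beta> :: complex
  assumes v: "v \<noteq> 0" and K: "K = {f. cinner f v = 0}"
    and eig: "backshift k v = \<beta> *\<^sub>C v"
begin

lemma shift_hyperplane: "f \<in> K \<Longrightarrow> shift k f \<in> K"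
  by (simp add: K cinner_shift_left eig cinner_scaleC_right)

lemma hyperplane_decomposition:
  assumes "f \<in> K"
  obtains h c where "h \<in> K" "f = shift k h + (taylor_poly k f + c *\<^sub>C shift k v)"
    "taylor_poly k f + c *\<^sub>C shift k v \<in> K \<ominus>\<^sub>H shift k ` K"
proof -
  define c where "c = cinner (backshift k f) v / cinner v v"
  define h where "h = backshift k f - c *\<^sub>C v"
  define r where "r = taylor_poly k f + c *\<^sub>C shift k v"
  have h: "h \<in> K"
    using v by (simp add: h_def K c_def cinner_diff_left cinner_scaleC_left)
  have f: "f = shift k h + r"
    using shift_decomposition[of f k] by (simp add: h_def r_def shift_diff shift_scaleC)
  have "r \<in> K"
  proof -
    have "cinner f v = cinner (shift k h) v + cinner r v"
      using arg_cong[OF f, of "\<lambda>x. cinner x v"] by (simp add: cinner_add_left)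
    then show ?thesis
      using assms shift_hyperplane[OF h] by (simp add: K)
  qed
  moreover have "cinner r (shift k x) = 0" if "x \<in> K" for x
    using that cinner_eq_0_commute[of x v]
    by (simp add: r_def cinner_shift_right backshift_add backshift_scaleC cinner_scaleC_left K)
  ultimately have "r \<in> K \<ominus>\<^sub>H shift k ` K"
    by (auto simp: ominus_def ortho_compl_def)
  with that h f show ?thesis
    unfolding r_def by blast
qed

lemma wandering_subspace_in_span:
  assumes "f \<in> K \<ominus>\<^sub>H shift k ` K"
  shows "f \<in> hardy.span (insert (shift k v) (hmonom ` {..<k}))"
proof -
  have fK: "f \<in> K" and fo: "\<And>x. x \<in> K \<Longrightarrow> cinner f (shift k x) = 0"
    using assms by (auto simp: ominus_def ortho_compl_def)
  obtain h c where h: "h \<in> K" and f: "f = shift k h + (taylor_poly k f + c *\<^sub>C shift k v)"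
    and r: "taylor_poly k f + c *\<^sub>C shift k v \<in> K \<ominus>\<^sub>H shift k ` K"
    by (rule hyperplane_decomposition[OF fK])
  have "cinner (shift k h) (shift k h) = cinner f (shift k h)
      - cinner (taylor_poly k f + c *\<^sub>C shift k v) (shift k h)"
    using arg_cong[OF f, of "\<lambda>x. cinner x (shift k h)"] by (simp add: cinner_add_left)
  also have "\<dots> = 0"
    using fo[OF h] r h by (auto simp: ominus_def ortho_compl_def)
  finally have "shift k h = 0"
    by simp
  with f have "f = taylor_poly k f + c *\<^sub>C shift k v"
    by (metis add_0)
  moreover have "taylor_poly k f + c *\<^sub>C shift k v
      \<in> hardy.span (insert (shift k v) (hmonom ` {..<k}))"
    using hardy.span_mono[of "hmonom ` {..<k}" "insert (shift k v) (hmonom ` {..<k})"]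
      taylor_poly_in_span[of k f]
    by (intro hardy.span_add hardy.span_scale) (auto intro: hardy.span_base)
  ultimately show ?thesis by simp
qed

text \<open>The span above may have dimension \<open>k + 1\<close>, but it is not contained in \<open>K\<close>.\<close>

lemma wandering_subspace_dim_le:
  assumes basis: "orthonormal_basis m g (K \<ominus>\<^sub>H shift k ` K)"
  shows "m \<le> k"
proof -
  let ?B = "insert (shift k v) (hmonom ` {..<k})"
  let ?G = "g ` {1..m}"
  have on: "cinner (g i) (g j) = (if i = j then 1 else 0)" if "i \<in> {1..m}" "j \<in> {1..m}" for i j
    using basis that by (auto simp: orthonormal_basis_def)
  have inj: "inj_on g {1..m}"
    by (rule inj_onI) (metis on zero_neq_one)
  have GK: "f \<in> K \<ominus>\<^sub>H shift k ` K" if "f \<in> hardy.span ?G" for f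
    using basis that by (simp add: orthonormal_basis_def)
  have indep: "\<not> hardy.dependent ?G"
    by (rule orthonormal_independent) (auto simp: on inj_on_eq_iff[OF inj])
  obtain w where w: "w \<in> ?B" "w \<notin> K"
  proof -
    \<comment> \<open>If all generators lay in \<open>K\<close>, the first \<open>k\<close>
      coefficients of \<open>v\<close> would vanish. Then \<open>v\<close> would be a multiple of
      \<open>shift k v\<close>, which is orthogonal to \<open>v\<close>.\<close>
    have "\<not> ?B \<subseteq> K"
    proof
      assume sub: "?B \<subseteq> K"
      have "hcoeff v n = 0" if "n < k" for n
        using sub that by (auto simp: K cinner_hmonom_left)
      then have "v = \<beta> *\<^sub>C shift k v"
        using shift_decomposition[of v k] by (simp add: taylor_poly_def eig shift_scaleC)
      then have "cinner v v = \<beta> * cinner (shift k v) v"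
        using cinner_scaleC_left by metis
      also have "\<dots> = 0"
        using sub by (simp add: K)
      finally show False using v by simp
    qed
    with that show ?thesis by blast
  qed
  have "w \<notin> hardy.span ?G"
    using GK w(2) by (auto simp: ominus_def)
  then have "\<not> hardy.dependent (insert w ?G)" "w \<notin> ?G"
    using indep hardy.independent_insertI hardy.span_base by auto
  moreover have "insert w ?G \<subseteq> hardy.span ?B"
  proof -
    have "w \<in> hardy.span ?B"
      using w(1) by (rule hardy.span_base)
    moreover have "f \<in> hardy.span ?B" if "f \<in> ?G" for f
      using that by (intro wandering_subspace_in_span GK hardy.span_base)
    ultimately show ?thesis
      by (simp add: subset_eq)
  qed
  \<comment> \<open>Adjoining \<open>w\<close> to the orthonormal family yields \<open>m + 1\<close>
    independent vectors in a span of at most \<open>k + 1\<close> generators.\<close>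
  ultimately have "card (insert w ?G) \<le> card ?B"
    using hardy.independent_span_bound[of ?B "insert w ?G"] by simp
  also have "\<dots> \<le> Suc (card (hmonom ` {..<k}))"
    by (rule card_insert_le_m1) auto
  also have "\<dots> \<le> Suc k"
    using card_image_le[of "{..<k}" hmonom] by simp
  finally show ?thesis
    using \<open>w \<notin> ?G\<close> card_image[OF inj] by simp
qed

end

section \<open>The rank-one perturbation of the shift\<close>

theorem theorem1p4:
  fixes k m :: nat and u v :: hardy and T :: "hardy \<Rightarrow> hardy" and K :: "hardy set"
    and g :: "nat \<Rightarrow> hardy"
  assumes "k \<ge> 1" and "u \<noteq> 0" and "v \<noteq> 0"
    and T_def: "T = (\<lambda>f. shift k f + (u \<otimes>\<^sub>H v) f)"
    and "\<not> isometric_op T"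
    and "dependent_pair v (cadjoint (shift k) u)"
    and K_def: "K = ker_op (\<lambda>f. f - cadjoint T (T f))"
    and "orthonormal_basis m g (K \<ominus>\<^sub>H shift k ` K)"
  shows "(quasinormal T \<longleftrightarrow>
            is_eigenvector (cadjoint (shift k)) v \<and>
            (\<forall>i\<in>{1..m}.
               (1 + cinner (cadjoint (shift k) u) v) * cinner (shift k v) (g i)
               + of_real ((norm v)\<^sup>2) * (\<Sum>n=0..k-1. cinner u (hmonom n) * cinner (hmonom n) (g i)) = 0))
         \<and> (shift k ` K \<subseteq> K \<longrightarrow> m \<le> k)"
proof -
  define B where "B = (\<lambda>f. backshift k f + (v \<otimes>\<^sub>H u) f)"
  obtain a b where ab: "a \<noteq> 0 \<or> b \<noteq> 0" "a *\<^sub>C v + b *\<^sub>C backshift k u = 0"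
    using assms(6) by (auto simp: dependent_pair_def cadjoint_shift)
  define \<alpha> where "\<alpha> = - a / b"
  have b: "b \<noteq> 0"
    using ab \<open>v \<noteq> 0\<close> by auto
  have \<alpha>: "backshift k u = \<alpha> *\<^sub>C v"
  proof (rule hardy_eqI)
    fix n
    have "a * hcoeff v n + b * hcoeff (backshift k u) n = 0"
      using arg_cong[OF ab(2), of "\<lambda>x. hcoeff x n"] by simp
    then show "hcoeff (backshift k u) n = hcoeff (\<alpha> *\<^sub>C v) n"
      using b by (simp add: \<alpha>_def field_simps eq_neg_iff_add_eq_0)
  qed
  \<comment> \<open>In \<open>B (T f)\<close> the cross terms contribute \<alpha> and its conjugate,
    and the product of the rank-one parts contributes \<open>cinner u u\<close>.\<close>
  define \<gamma> where "\<gamma> = \<alpha> + cnj \<alpha> + cinner u u"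
  have adjT: "cinner (T f) h = cinner f (B h)" for f h
    unfolding T_def B_def by (rule cinner_shift_plus_rank_one)
  have cadjT: "cadjoint T = B"
    by (rule cadjointI) (rule adjT)
  have defect: "B (T f) = f + (\<gamma> * cinner f v) *\<^sub>C v" for f
    by (rule hardy_eqI)
      (simp add: T_def B_def rank_one_def backshift_add backshift_scaleC \<alpha> \<gamma>_def cinner_add_left
        cinner_scaleC_left cinner_scaleC_right cinner_shift_left algebra_simps)
  have "\<gamma> \<noteq> 0"
  proof
    assume "\<gamma> = 0"
    then have "cinner (T f) (T f) = cinner f f" for f
      by (simp add: adjT defect)
    then have "norm (T f) = norm f" for f
      by (simp add: norm_hardy_def)
    with \<open>\<not> isometric_op T\<close> show False
      by (simp add: isometric_op_def)
  qed
  have K: "K = {f. cinner f v = 0}"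
    using \<open>\<gamma> \<noteq> 0\<close> \<open>v \<noteq> 0\<close> by (auto simp: K_def ker_op_def cadjT defect)
  have qn: "quasinormal T \<longleftrightarrow> (\<exists>c. T v = c *\<^sub>C v) \<and> (\<exists>d. B v = d *\<^sub>C v)"
  proof (rule quasinormal_iff_reduces[OF _ _ adjT defect \<open>\<gamma> \<noteq> 0\<close> \<open>v \<noteq> 0\<close>])
    show "T (f + h) = T f + T h" for f h
      by (simp add: T_def rank_one_def shift_add cinner_add_left hardy.scale_left_distrib)
    show "T (c *\<^sub>C f) = c *\<^sub>C T f" for c f
      by (simp add: T_def rank_one_def shift_scaleC cinner_scaleC_left hardy.scale_right_distrib)
  qed
  have eigB: "(\<exists>d. B v = d *\<^sub>C v) \<longleftrightarrow> is_eigenvector (backshift k) v"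
  proof -
    \<comment> \<open>\<open>B\<close> and \<open>backshift k\<close> differ at \<open>v\<close> by
      a multiple of \<open>v\<close>, so only the eigenvalue moves, by
      \<open>cinner v u\<close>.\<close>
    have "B v = d *\<^sub>C v \<longleftrightarrow> backshift k v = (d - cinner v u) *\<^sub>C v" for d
      by (auto simp: B_def rank_one_def hardy.scale_left_diff_distrib eq_diff_eq)
    then show ?thesis
      using \<open>v \<noteq> 0\<close> unfolding is_eigenvector_def by (metis add_diff_cancel_right')
  qed
  have Tv: "(1 + cinner (backshift k u) v) * cinner (shift k v) (g i)
      + of_real ((norm v)\<^sup>2) * (\<Sum>n=0..k-1. cinner u (hmonom n) * cinner (hmonom n) (g i))
      = cinner (T v) (g i)" for i
  proof -
    \<comment> \<open>Subtraction is truncated: at \<open>k = 0\<close> the left side would still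
      contain \<open>0\<close>.\<close>
    have "{0..k-1} = {..<k}"
      using \<open>k \<ge> 1\<close> by auto
    \<comment> \<open>Substituting this into \<open>T v = shift k v + cinner v v *\<^sub>C u\<close>
      makes \<open>cinner (backshift k u) v\<close>, which is \<alpha> times
      \<open>cinner v v\<close>, appear in the first factor.\<close>
    moreover have "cinner u (g i) = \<alpha> * cinner (shift k v) (g i) + cinner (taylor_poly k u) (g i)"
      using arg_cong[OF shift_decomposition[of u k], of "\<lambda>y. cinner y (g i)"]
      by (simp add: \<alpha> shift_scaleC cinner_add_left cinner_scaleC_left)
    ultimately show ?thesis
      unfolding cinner_self_norm[symmetric]
      by (simp only: cinner_taylor_poly_left[symmetric])
        (simp add: T_def rank_one_def cinner_add_left cinner_scaleC_left \<alpha> algebra_simps)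
  qed
  have Tv_eig: "(\<exists>c. T v = c *\<^sub>C v) \<longleftrightarrow> (\<forall>i\<in>{1..m}. cinner (T v) (g i) = 0)"
    if eig: "is_eigenvector (backshift k) v"
  proof
    assume "\<exists>c. T v = c *\<^sub>C v"
    then show "\<forall>i\<in>{1..m}. cinner (T v) (g i) = 0"
      using orthonormal_basis_in[OF assms(8)] cinner_eq_0_commute
      by (fastforce simp: cinner_scaleC_left ominus_def K)
  next
    assume *: "\<forall>i\<in>{1..m}. cinner (T v) (g i) = 0"
    obtain \<beta> where \<beta>: "backshift k v = \<beta> *\<^sub>C v"
      using eig by (auto simp: is_eigenvector_def)
    show "\<exists>c. T v = c *\<^sub>C v"
    proof (rule proportionalI[OF \<open>v \<noteq> 0\<close>])
      fix f assume "cinner f v = 0"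
      then have "f \<in> K" by (simp add: K)
      then obtain h r where h: "h \<in> K" and f: "f = shift k h + r" and r: "r \<in> K \<ominus>\<^sub>H shift k ` K"
        using hyperplane_decomposition[OF \<open>v \<noteq> 0\<close> K \<beta>] by metis
      have "backshift k (T v) = (1 + cinner v v * \<alpha>) *\<^sub>C v"
        by (simp add: T_def rank_one_def backshift_add backshift_scaleC \<alpha> hardy.scale_left_distrib)
      then have "cinner (T v) (shift k h) = 0"
        using h cinner_eq_0_commute[of h v] by (simp add: cinner_shift_right cinner_scaleC_left K)
      moreover have "cinner (T v) r = 0"
        by (rule orthonormal_basis_orthogonal_all[OF assms(8) _ r]) (use * in blast)
      ultimately show "cinner (T v) f = 0"
        by (simp add: f cinner_add_right)
    qed
  qed
  have "m \<le> k" if sub: "shift k ` K \<subseteq> K"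
  proof -
    \<comment> \<open>Here the eigenvector property comes from invariance of \<open>K\<close> alone:
      \<open>backshift k v\<close> is orthogonal to every \<open>h\<close> orthogonal to
      \<open>v\<close>.\<close>
    have "\<exists>\<beta>. backshift k v = \<beta> *\<^sub>C v"
    proof (rule proportionalI[OF \<open>v \<noteq> 0\<close>])
      fix h assume "cinner h v = 0"
      then have "shift k h \<in> K"
        using sub by (auto simp: K)
      then show "cinner (backshift k v) h = 0"
        by (simp add: K cinner_eq_0_commute[of _ v] flip: cinner_shift_right)
    qed
    then show ?thesis
      using wandering_subspace_dim_le[OF \<open>v \<noteq> 0\<close> K _ assms(8)] by blast
  qed
  then show ?thesis
    unfolding cadjoint_shift Tv qn eigB using Tv_eig by blast
qed

end
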